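(* Let $\eta>0$, let $k,d,T\ge 1$ be integers, let $j\in\{1,\dots,k\}$ be a cluster index and $t\in\{1,\dots,T\}$ an iteration index, and let $\tilde\mu_1^{(t-1)},\dots,\tilde\mu_k^{(t-1)}\in\mathbb{R}^d$ be the (already published, fixed) centroids of iteration $t-1$. For a finite dataset $D$ of points in $\mathbb{R}^d$, let $O_j^{(t)}(D)$ be the cluster produced by the radius-constrained assignment step, so that the constraint $$\|x-\tilde\mu_j^{(t-1)}\|_2\le \eta\qquad\text{for all }x\in O_j^{(t)}(D)$$ is satisfied for every cluster $j$, and let $$R_j^{(t)}(D)=\sum_{x\in O_j^{(t)}(D)}\bigl(x-\tilde\mu_j^{(t-1)}\bigr)$$ be the relative sum. Then $$\Delta^{R}=\max_{D,D'}\bigl\|R_j^{(t)}(D)-R_j^{(t)}(D')\bigr\|_2\le \eta ,$$ where the maximum is over all pairs of neighbouring datasets $D,D'$; this holds for all clusters $j\in\{1,\dots,k\}$ and all iterations $t\in\{1,\dots,T\}$.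
   Context: Datasets are finite collections (multisets) of points in $\mathbb{R}^d$. Two datasets are neighbouring if one is obtained from the other by adding or removing a single data point. Radius-constrained assignment step at iteration $t$: each data point $x\in D$ is considered for the cluster $j'$ whose centroid $\tilde\mu_{j'}^{(t-1)}$ is nearest to $x$ in Euclidean distance (ties broken by a fixed rule depending only on $x$ and the centroids); if $\|x-\tilde\mu_{j'}^{(t-1)}\|_2\le\eta$ then $x$ is placed in $O_{j'}^{(t)}(D)$, and otherwise $x$ is discarded and belongs to no cluster. The same centroids $\tilde\mu^{(t-1)}$ are used for $D$ and $D'$. An empty sum is $0$. *)

theory Defs
  imports "HOL-Analysis.Analysis" "HOL-Library.Multiset" "HOL-Library.Extended_Real"
begin

definition neighbouring :: "'a multiset \<Rightarrow> 'a multiset \<Rightarrow> bool" where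
  "neighbouring D D' \<longleftrightarrow> (\<exists>x. D' = add_mset x D \<or> D = add_mset x D')"

text \<open>Centroids are functions \<open>\<mu>\<close> on \<open>nat\<close>, of which only the indices \<open>{1..k}\<close> matter.
  An assignment rule chooses a cluster index from a point and the centroids. It does not see
  the dataset; on ties, it may choose any of the nearest centroids.\<close>

definition nearest_rule :: "nat \<Rightarrow> (real ^ 'd \<Rightarrow> (nat \<Rightarrow> real ^ 'd) \<Rightarrow> nat) \<Rightarrow> bool" where
  "nearest_rule k sel \<longleftrightarrow>
     (\<forall>x \<mu>. is_arg_min (\<lambda>i. norm (x - \<mu> i)) (\<lambda>i. i \<in> {1..k}) (sel x \<mu>))"

definition cluster ::
  "(real ^ 'd \<Rightarrow> (nat \<Rightarrow> real ^ 'd) \<Rightarrow> nat) \<Rightarrow> real \<Rightarrow> (nat \<Rightarrow> real ^ 'd) \<Rightarrow> nat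
    \<Rightarrow> (real ^ 'd) multiset \<Rightarrow> (real ^ 'd) multiset" where
  "cluster sel \<eta> \<mu> j D = {# x \<in># D. sel x \<mu> = j \<and> norm (x - \<mu> (sel x \<mu>)) \<le> \<eta> #}"

definition relative_sum ::
  "(real ^ 'd \<Rightarrow> (nat \<Rightarrow> real ^ 'd) \<Rightarrow> nat) \<Rightarrow> real \<Rightarrow> (nat \<Rightarrow> real ^ 'd) \<Rightarrow> nat
    \<Rightarrow> (real ^ 'd) multiset \<Rightarrow> real ^ 'd" where
  "relative_sum sel \<eta> \<mu> j D = (\<Sum>x\<in>#cluster sel \<eta> \<mu> j D. x - \<mu> j)"

text \<open>The supremum is taken in \<open>ereal\<close>, so an unbounded \<open>f\<close> has sensitivity \<open>\<infinity>\<close>.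
  A supremum replaces the maximum, which need not be attained when ties are resolved
  away from a cluster.\<close>

definition sensitivity :: "('a multiset \<Rightarrow> 'b::real_normed_vector) \<Rightarrow> ereal" where
  "sensitivity f = (SUP (D, D') \<in> {(D, D'). neighbouring D D'}. ereal (norm (f D - f D')))"

lemma cluster_radius:
  assumes "x \<in># cluster sel \<eta> \<mu> j D"
  shows "norm (x - \<mu> j) \<le> \<eta>"
  using assms by (auto simp: cluster_def)

end

theory Submission
  imports Defs
begin

text \<open>The assignment of a point depends only on that point and the fixed centroids, so
  inserting \<open>x\<close> moves no other point between clusters. Hence
  \<open>relative_sum\<close> changes by at most the single term \<open>x - \<mu> j\<close>, which
  the radius constraint bounds by \<open>\<eta>\<close>.\<close>

lemma sensitivity_le:
  assumes "\<And>D x. norm (f (add_mset x D) - f D) \<le> B"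
  shows "sensitivity f \<le> ereal B"
proof -
  \<comment> \<open>Removal is insertion with the two datasets exchanged, and the norm of the
    difference is symmetric.\<close>
  have "norm (f D - f D') \<le> B" if "neighbouring D D'" for D D'
    using that assms by (auto simp: neighbouring_def norm_minus_commute)
  then show ?thesis
    unfolding sensitivity_def by (intro SUP_least) auto
qed

text \<open>\<open>cluster\<close> is a pointwise filter, so the terms from \<open>D\<close> cancel.
  Phrasing acceptance of \<open>x\<close> through the singleton dataset lets
  \<open>cluster_radius\<close> apply as is.\<close>

lemma relative_sum_add_mset:
  "relative_sum sel \<eta> \<mu> j (add_mset x D) - relative_sum sel \<eta> \<mu> j D =
     (if x \<in># cluster sel \<eta> \<mu> j {#x#} then x - \<mu> j else 0)"
  by (auto simp: relative_sum_def cluster_def)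

theorem theorem5p1:
  fixes \<eta> :: real and k T :: nat
    and \<mu> :: "nat \<Rightarrow> nat \<Rightarrow> real ^ 'd"
    and sel :: "real ^ 'd \<Rightarrow> (nat \<Rightarrow> real ^ 'd) \<Rightarrow> nat"
  assumes "\<eta> > 0" and "k \<ge> 1" and "T \<ge> 1"
    and "nearest_rule k sel"
  shows "\<forall>t\<in>{1..T}. \<forall>j\<in>{1..k}. sensitivity (relative_sum sel \<eta> (\<mu> (t - 1)) j) \<le> ereal \<eta>"
proof (intro ballI sensitivity_le)
  fix t j :: nat and D :: "(real ^ 'd) multiset" and x :: "real ^ 'd"
  show "norm (relative_sum sel \<eta> (\<mu> (t - 1)) j (add_mset x D)
      - relative_sum sel \<eta> (\<mu> (t - 1)) j D) \<le> \<eta>"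
    \<comment> \<open>Positivity of \<open>\<eta>\<close> settles the case where \<open>x\<close>
      does not enter cluster \<open>j\<close> and the difference is 0.\<close>
    using assms(1) cluster_radius[of x sel \<eta> "\<mu> (t - 1)" j "{#x#}"]
    by (simp add: relative_sum_add_mset)
qed

end
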